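(* Let $m\geq 1$ be an integer. The polynomial $f(x)=x^3+x^2+1$ is stable over $\mathbb{F}_{2^m}$ if and only if $3\nmid m$.
   Context: For a field $K$, a polynomial $t(x)\in K[x]$ is called stable over $K$ if for every integer $n\ge 1$ the $n$-th iterate $t^{(n)}(x)=t(t(\cdots t(x)\cdots))$ ($n$-fold composition) is irreducible over $K$. *)

theory Defs
  imports
    "HOL-Library.Cardinality"
    "HOL-Computational_Algebra.Polynomial_Factorial"
begin

definition poly_iterate :: "'a::comm_semiring_1 poly \<Rightarrow> nat \<Rightarrow> 'a poly" where
  "poly_iterate t n = (pcompose t ^^ n) [:0, 1:]"

text \<open>The field $K$ is the coefficient type, so irreducibility is irreducibility over $K$.\<close>

definition stable_poly :: "'a::field poly \<Rightarrow> bool" where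
  "stable_poly t \<longleftrightarrow> (\<forall>n\<ge>1. irreducible (poly_iterate t n))"

end

theory Submission
  imports
    "HOL-Algebra.Algebraic_Closure_Type"
    "HOL-Number_Theory.Residues"
    Defs
begin

text \<open>
  In characteristic 2, the shift $x \mapsto x + 1$ conjugates $f$ to the Dickson polynomial
  $x^3 + x$, which maps $z + 1/z$ to $z^3 + 1/z^3$. Hence the roots of the $n$-th iterate of $f$ are
  the elements $z + 1/z + 1$ with $z$ a primitive $3^{n+1}$-th root of unity. As 2 is a primitive
  root modulo every power of 3, such an element has $3^n$ distinct conjugates over
  $\mathbb{F}_{2^m}$ if $3 \nmid m$, so every nonconstant factor of the iterate has full degree. If
  $3 \mid m$, then $f$ itself already has a root in $\mathbb{F}_8 \subseteq \mathbb{F}_{2^m}$.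
\<close>

section \<open>Finite fields and Frobenius powers\<close>

text \<open>For nonzero \<open>x\<close>, multiplication by \<open>x\<close> permutes the nonzero
  elements; comparing products over them gives \<open>x ^ (CARD('a) - 1) = 1\<close>.\<close>

lemma finite_field_power_card:
  fixes x :: "'a::field"
  assumes "finite (UNIV :: 'a set)"
  shows "x ^ CARD('a) = x"
proof (cases "x = 0")
  case False
  have pos: "CARD('a) > 0"
    using assms by (simp add: card_gt_0_iff)
  have "(\<Prod>y\<in>UNIV-{0}. x * y) = x ^ (CARD('a) - 1) * \<Prod>(UNIV-{0})"
    by (simp add: prod.distrib)
  moreover have "(\<Prod>y\<in>UNIV-{0}. x * y) = \<Prod>(UNIV-{0})"
    by (rule prod.reindex_bij_witness[of _ "\<lambda>y. y / x" "\<lambda>y. x * y"]) (use False in auto)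
  moreover have "\<Prod>(UNIV-{0::'a}) \<noteq> 0"
    using assms by simp
  ultimately have "x ^ (CARD('a) - 1) = 1"
    by simp
  then show ?thesis
    using pos by (cases "CARD('a)") auto
qed (use assms in \<open>simp add: card_gt_0_iff zero_power\<close>)

lemma char_2_of_card:
  assumes "m \<ge> 1" and "CARD('a::field) = 2 ^ m"
  shows "CHAR('a) = 2"
proof -
  have fin: "finite (UNIV :: 'a set)"
    using assms by (intro card_ge_0_finite) simp
  have "prime CHAR('a)"
    using prime_CHAR_semidom[where ?'a = 'a] finite_imp_CHAR_pos[OF fin] by simp
  moreover have "CHAR('a) dvd 2 ^ m"
    using CHAR_dvd_CARD[where ?'a = 'a] assms by simp
  ultimately show ?thesis
    using prime_dvd_power primes_dvd_imp_eq two_is_prime_nat by blast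
qed

text \<open>By additivity of Frobenius, equal powers give
  \<open>(x - y) ^ (CHAR('b) ^ k) = 0\<close>, and a domain has no nonzero nilpotents.\<close>

lemma inj_power_CHAR_power:
  assumes "prime CHAR('b::idom)"
  shows "inj (\<lambda>x::'b. x ^ (CHAR('b) ^ k))"
proof (rule injI)
  fix x y :: 'b
  assume eq: "x ^ (CHAR('b) ^ k) = y ^ (CHAR('b) ^ k)"
  have "x ^ (CHAR('b) ^ k) = (x - y) ^ (CHAR('b) ^ k) + y ^ (CHAR('b) ^ k)"
    using freshmans_dream'[OF assms refl, of "x - y" y k] by simp
  with eq show "x = y"
    by simp
qed

section \<open>Evaluating polynomials in the algebraic closure\<close>

lemma poly_map_to_ac_add:
  "poly (map_poly to_ac (p + q)) x = poly (map_poly to_ac p) x + poly (map_poly to_ac q) x"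
  by (induction p q rule: poly_induct2) (simp_all add: map_poly_pCons algebra_simps)

lemma poly_map_to_ac_smult:
  "poly (map_poly to_ac (smult c p)) x = to_ac c * poly (map_poly to_ac p) x"
  by (induction p) (simp_all add: map_poly_pCons algebra_simps)

lemma poly_map_to_ac_mult:
  "poly (map_poly to_ac (p * q)) x = poly (map_poly to_ac p) x * poly (map_poly to_ac q) x"
  by (induction p)
     (simp_all add: map_poly_pCons poly_map_to_ac_add poly_map_to_ac_smult algebra_simps)

lemma poly_map_to_ac_pcompose:
  "poly (map_poly to_ac (pcompose p q)) x = poly (map_poly to_ac p) (poly (map_poly to_ac q) x)"
  by (induction p)
     (simp_all add: map_poly_pCons poly_map_to_ac_add poly_map_to_ac_mult pcompose_pCons)

lemma poly_map_to_ac_iterate: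
  "poly (map_poly to_ac (poly_iterate p n)) x = (poly (map_poly to_ac p) ^^ n) x"
  unfolding poly_iterate_def
  by (induction n) (simp_all add: poly_map_to_ac_pcompose map_poly_pCons)

lemma degree_poly_iterate:
  "degree (poly_iterate (p :: 'a::field poly) n) = degree p ^ n"
  unfolding poly_iterate_def by (induction n) (simp_all add: degree_pcompose)

text \<open>Raising to the power \<open>CARD('a)\<close> is additive and fixes the coefficients,
  which come from the base field. Hence the roots of \<open>p\<close> are closed under
  conjugation.\<close>

lemma poly_map_to_ac_frobenius:
  fixes p :: "'a::field poly"
  assumes "prime CHAR('a)" and "CARD('a) = CHAR('a) ^ m"
  shows "poly (map_poly to_ac p) (x ^ CARD('a)) = poly (map_poly to_ac p) x ^ CARD('a)"
proof (induction p)
  case 0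
  then show ?case
    using assms by (simp add: prime_gt_0_nat)
next
  case (pCons c p)
  have fin: "finite (UNIV :: 'a set)"
    using assms by (intro card_ge_0_finite) (simp add: prime_gt_0_nat)
  have "to_ac c ^ CARD('a) = to_ac c"
    using finite_field_power_card[OF fin, of c] by (metis to_ac_power)
  moreover have "(u + v) ^ CARD('a) = u ^ CARD('a) + v ^ CARD('a)" for u v :: "'a alg_closure"
    using assms by (intro freshmans_dream'[where n = m]) auto
  ultimately show ?case
    using pCons by (simp add: map_poly_pCons power_mult_distrib)
qed

section \<open>Orders of roots of unity, and powers of 4 modulo powers of 3\<close>

text \<open>The order of \<open>z\<close> is exactly \<open>p ^ Suc n\<close>. By Bezout,
  \<open>z\<close> raised to the gcd of \<open>e\<close> and \<open>p ^ Suc n\<close> is 1 as well;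
  were this gcd a smaller power of \<open>p\<close>, it would divide \<open>p ^ n\<close>.\<close>

lemma pow_dvd_of_power_eq_1:
  fixes z :: "'b::field"
  assumes p: "prime (p::nat)" and "z ^ (p ^ Suc n) = 1" and "z ^ (p ^ n) \<noteq> 1" and "z ^ e = 1"
  shows "p ^ Suc n dvd e"
proof (cases "e = 0")
  case False
  define d where "d = gcd e (p ^ Suc n)"
  obtain x y where "e * x = p ^ Suc n * y + d"
    using bezout_nat[OF False, of "p ^ Suc n"] by (auto simp: d_def)
  then have "z ^ (e * x) = z ^ (p ^ Suc n * y) * z ^ d"
    by (simp only: power_add)
  then have d1: "z ^ d = 1"
    using assms by (simp only: power_mult power_one mult_1_left)
  obtain j where j: "j \<le> Suc n" "d = p ^ j"
    using divides_primepow_nat[OF p, of d "Suc n"] by (auto simp: d_def)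
  have "j = Suc n"
  proof (rule ccontr)
    assume "j \<noteq> Suc n"
    with j have "p ^ n = d * p ^ (n - j)"
      by (simp flip: power_add)
    then have "z ^ (p ^ n) = 1"
      using d1 by (simp add: power_mult)
    with assms show False by simp
  qed
  with j show ?thesis
    by (metis d_def gcd_dvd1)
qed auto

text \<open>If $e = 3k$, then $4^e - 1 = (4^k - 1)(4^{2k} + 4^k + 1)$, and 9 does not divide the
  second factor.\<close>

lemma three_power_dvd_exponent:
  "(3::int) ^ Suc n dvd 4 ^ e - 1 \<Longrightarrow> 3 ^ n dvd e"
proof (induction n arbitrary: e)
  case (Suc n)
  have "(9::int) dvd 3 ^ Suc (Suc n)"
    by simp
  then have "(9::int) dvd 4 ^ e - 1"
    using Suc.prems dvd_trans by blast
  then have "[4 ^ e = 1] (mod (9::int))"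
    by (simp add: cong_iff_dvd_diff)
  \<comment> \<open>Since \<open>4 ^ 3 = 64\<close> is 1 modulo 9, only \<open>e mod 3\<close>
    matters, and among 1, 4, 16 only the first is 1 modulo 9.\<close>
  moreover have "[4 ^ e = 4 ^ (e mod 3)] (mod (9::int))"
  proof -
    have "(4::int) ^ e = (4 ^ 3) ^ (e div 3) * 4 ^ (e mod 3)"
      unfolding power_mult[symmetric] power_add[symmetric] by simp
    moreover have "[(4 ^ 3) ^ (e div 3) * 4 ^ (e mod 3) = 1 ^ (e div 3) * 4 ^ (e mod 3)] (mod (9::int))"
      by (intro cong_mult cong_pow cong_refl) (simp add: cong_def)
    ultimately show ?thesis
      by simp
  qed
  ultimately have "[4 ^ (e mod 3) = 1] (mod (9::int))"
    using cong_sym cong_trans by blast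
  moreover have "e mod 3 \<in> {0, 1, 2}"
    by auto
  ultimately have "e mod 3 = 0"
    by (auto simp: cong_def)
  then obtain k where k: "e = 3 * k" by auto
  have "[4 ^ k = 1 ^ k] (mod (3::int))"
    by (intro cong_pow) (simp add: cong_def)
  then have "(3::int) dvd 4 ^ k - 1"
    by (simp add: cong_iff_dvd_diff)
  then obtain t where "(4::int) ^ k - 1 = 3 * t" ..
  then have t: "(4::int) ^ k = 1 + 3 * t"
    by simp
  have "(4::int) ^ e = (4 ^ k) ^ 3"
    unfolding k by (metis power_mult mult.commute)
  \<comment> \<open>The factor \<open>4 ^ (2 * k) + 4 ^ k + 1\<close> equals
    \<open>3 * (1 + 3 * (t + t^2))\<close>, so it accounts for exactly one factor 3.\<close>
  then have "(4::int) ^ e - 1 = 3 * ((4 ^ k - 1) * (1 + 3 * (t + t^2)))"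
    unfolding t by (simp add: algebra_simps power2_eq_square power3_eq_cube)
  then have "(3::int) * 3 ^ Suc n dvd 3 * ((4 ^ k - 1) * (1 + 3 * (t + t^2)))"
    using Suc.prems by (metis power_Suc)
  then have "(3::int) ^ Suc n dvd (4 ^ k - 1) * (1 + 3 * (t + t^2))"
    unfolding dvd_mult_cancel_left by simp
  moreover have "coprime ((3::int) ^ Suc n) (1 + 3 * (t + t^2))"
  proof -
    have "coprime (3::int) (1 + 3 * (t + t^2))"
      by (rule coprimeI) (metis dvd_add_left_iff dvd_triv_left dvd_trans)
    then show ?thesis by simp
  qed
  ultimately have "3 ^ n dvd k"
    by (intro Suc.IH) (simp only: coprime_dvd_mult_left_iff)
  then show ?case
    by (simp add: k)
qed simp

section \<open>Iterates and conjugates in characteristic 2\<close>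

lemma iterate_at_reciprocal_sum:
  fixes y :: "'b::field"
  assumes "CHAR('b) = 2" and "y \<noteq> 0"
  shows "((\<lambda>x. x ^ 3 + x ^ 2 + 1) ^^ n) (y + 1 / y + 1) = y ^ (3 ^ n) + 1 / y ^ (3 ^ n) + 1"
proof (induction n)
  case (Suc n)
  have two: "(2::'b) = 0"
    using of_nat_CHAR[where ?'a = 'b] assms by simp
  have step: "(u + v + 1) ^ 3 + (u + v + 1) ^ 2 + 1 = u ^ 3 + v ^ 3 + 1"
    if "u * v = 1" for u v :: 'b
  proof -
    \<comment> \<open>The grouping isolates \<open>u * v\<close>: once it is 1, the last two terms
      add up to \<open>6 * (u + v)\<close>, and everything except the cubes and 1 is a multiple of
      2.\<close>
    have "(u + v + 1) ^ 3 + (u + v + 1) ^ 2 + 1 =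
        u ^ 3 + v ^ 3 + 1 + 2 * (2 * (u + v) ^ 2 + (u + v) + 1) + 3 * (u * v) * (u + v) + 3 * (u + v)"
      by (simp add: algebra_simps power2_eq_square power3_eq_cube)
    also have "\<dots> = u ^ 3 + v ^ 3 + 1 + 2 * (2 * (u + v) ^ 2 + 4 * (u + v) + 1)"
      using that by (simp add: algebra_simps)
    finally show ?thesis
      using two by simp
  qed
  have "y ^ (3 ^ n) * (1 / y ^ (3 ^ n)) = 1"
    using assms by simp
  from step[OF this] show ?case
    by (simp add: Suc.IH power_one_over mult.commute flip: power_mult)
qed simp

text \<open>Writing a root as $z + 1/z + 1$, the hypothesis says that $z^{3^n}$ is a primitive cube root
  of unity. Two equal conjugates force $z^{q^i} = z^{\pm q^j}$, hence $z^{q^{2(j-i)} - 1} = 1$.\<close>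

lemma conjugates_distinct:
  fixes x :: "'b::alg_closed_field"
  assumes char: "CHAR('b) = 2" and m: "\<not> 3 dvd m"
    and root: "((\<lambda>x. x ^ 3 + x ^ 2 + 1) ^^ n) x = 0"
  shows "inj_on (\<lambda>i. x ^ ((2 ^ m) ^ i)) {..<3 ^ n}"
proof -
  have two: "(2::'b) = 0"
    using of_nat_CHAR[where ?'a = 'b] char by simp
  have neg: "- u = u" for u :: 'b
    by (rule uminus_CHAR_2) (rule char)
  have frob: "(u + v) ^ ((2 ^ m) ^ i) = u ^ ((2 ^ m) ^ i) + v ^ ((2 ^ m) ^ i)" for u v :: 'b and i
    by (rule freshmans_dream'[where n = "m * i"]) (simp_all add: char power_mult)
  \<comment> \<open>In characteristic 2 this quadratic is \<open>x = z + 1 / z + 1\<close> cleared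
    of denominators.\<close>
  obtain z :: 'b where "poly [:1, x + 1, 1:] z = 0"
    using alg_closed_imp_poly_has_root[of "[:1, x + 1, 1:]"] by auto
  then have z: "1 + z * (x + 1 + z) = 0"
    by simp
  then have z0: "z \<noteq> 0"
    by auto
  have xz: "x = z + 1 / z + 1"
  proof -
    have "z * x + (z * z + 1 + z) = 0"
      using z by (simp add: algebra_simps)
    then have "z * x = z * z + 1 + z"
      by (metis neg eq_neg_iff_add_eq_0)
    also have "\<dots> = z * (z + 1 / z + 1)"
      using z0 by (simp add: algebra_simps)
    finally show ?thesis using z0 by simp
  qed
  define w where "w = z ^ (3 ^ n)"
  have w0: "w \<noteq> 0" using z0 by (simp add: w_def)
  have "w + 1 / w + 1 = 0"
    using root iterate_at_reciprocal_sum[OF char z0, of n] by (simp add: xz w_def)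
  then have "w * (w + 1 / w + 1) = 0"
    by simp
  then have w: "w ^ 2 + w + 1 = 0"
    using w0 by (simp add: algebra_simps power2_eq_square)
  have "w ^ 3 - 1 = (w - 1) * (w ^ 2 + w + 1)"
    by (simp add: algebra_simps power2_eq_square power3_eq_cube)
  then have w3: "z ^ (3 ^ Suc n) = 1"
    using w by (simp add: w_def mult.commute flip: power_mult)
  \<comment> \<open>\<open>w = 1\<close> would give \<open>3 = 0\<close>, which together with
    \<open>2 = 0\<close> is impossible.\<close>
  have w1: "z ^ (3 ^ n) \<noteq> 1"
    using w two by (auto simp flip: w_def)
  have main: False if "i < j" "j < 3 ^ n" "x ^ ((2 ^ m) ^ i) = x ^ ((2 ^ m) ^ j)" for i j
  proof -
    define d where "d = j - i"
    have j: "j = i + d"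
      using that by (simp add: d_def)
    define a where "a = z ^ ((2 ^ m) ^ i)"
    define b where "b = z ^ ((2 ^ m) ^ j)"
    have ab0: "a \<noteq> 0" "b \<noteq> 0"
      using z0 by (auto simp: a_def b_def)
    have "a + 1 / a = b + 1 / b"
      using that(3) by (simp add: xz frob a_def b_def power_one_over)
    then have "a * b * (a + 1 / a) = a * b * (b + 1 / b)"
      by simp
    then have "(a - b) * (a * b - 1) = 0"
      using ab0 by (simp add: algebra_simps)
    then have ab: "a = b \<or> a * b = 1"
      by auto
    have b: "b = a ^ ((2 ^ m) ^ d)"
      unfolding a_def b_def j by (simp add: power_add power_mult)
    \<comment> \<open>Raising to the power \<open>(2 ^ m) ^ d\<close> sends \<open>a\<close> to
      itself or to its inverse, so doing it twice fixes \<open>a\<close>.\<close>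
    have "a ^ ((2 ^ m) ^ d * (2 ^ m) ^ d) = a"
      using ab
    proof
      assume "a = b"
      then show ?thesis using b by (metis power_mult)
    next
      assume *: "a * b = 1"
      have "a ^ ((2 ^ m) ^ d) * b ^ ((2 ^ m) ^ d) = 1"
        using * by (metis power_mult_distrib power_one)
      then have "b * b ^ ((2 ^ m) ^ d) = 1"
        using b by simp
      with * have "b ^ ((2 ^ m) ^ d) = a"
        by (metis mult.commute mult_cancel_left ab0(2))
      then show ?thesis using b by (simp add: power_mult)
    qed
    \<comment> \<open>Both sides are \<open>2 ^ (m * i)\<close>-th powers; injectivity of that power
      map carries the relation from \<open>a\<close> back to \<open>z\<close>.\<close>
    then have "(z ^ ((2 ^ m) ^ d * (2 ^ m) ^ d)) ^ (2 ^ (m * i)) = z ^ (2 ^ (m * i))"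
      by (simp add: a_def power_mult mult.commute flip: power_mult)
    then have "z ^ ((2 ^ m) ^ d * (2 ^ m) ^ d) = z"
      using inj_power_CHAR_power[where ?'b = 'b, of "m * i"] char by (simp add: inj_def)
    moreover have "(2 ^ m) ^ d * (2 ^ m) ^ d = (4::nat) ^ (m * d)"
      by (simp add: power_mult flip: power_mult_distrib)
    ultimately have "z ^ (4 ^ (m * d) - 1) * z = 1 * z"
      by (simp flip: power_Suc2)
    then have "z ^ (4 ^ (m * d) - 1) = 1"
      using z0 by simp
    then have "(3::nat) ^ Suc n dvd 4 ^ (m * d) - 1"
      by (intro pow_dvd_of_power_eq_1[OF _ w3 w1]) simp_all
    then have "int (3 ^ Suc n) dvd int (4 ^ (m * d) - 1)"
      by (simp only: of_nat_dvd_iff)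
    then have "3 ^ n dvd m * d"
      by (intro three_power_dvd_exponent) (simp add: of_nat_diff)
    \<comment> \<open>Here \<open>3\<close> not dividing \<open>m\<close> enters: it makes
      \<open>3 ^ n\<close> divide \<open>d\<close>, which lies strictly between 0 and
      \<open>3 ^ n\<close>.\<close>
    moreover have "coprime (3 ^ n) m"
      using m by (simp add: prime_imp_coprime)
    ultimately have "3 ^ n dvd d"
      by (simp add: coprime_dvd_mult_right_iff)
    moreover have "0 < d" "d < 3 ^ n"
      using that by (auto simp: d_def)
    ultimately show False
      using nat_dvd_not_less by blast
  qed
  show ?thesis
    by (rule linorder_inj_onI') (use main in auto)
qed

section \<open>Irreducibility over the field with \<open>2 ^ m\<close> elements\<close>

context
  fixes f :: "'a::field poly" and m :: nat
  assumes m: "m \<ge> 1" and card: "CARD('a) = 2 ^ m" and f: "f = monom 1 3 + monom 1 2 + 1"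
begin

lemma char: "CHAR('a) = 2"
  using char_2_of_card m card by blast

lemma degree_f: "degree f = 3"
proof -
  have "f = [:1, 0, 1, 1:]"
    unfolding f by (simp add: monom_altdef numeral_eq_Suc one_pCons)
  then show ?thesis by simp
qed

lemma poly_f_ac: "poly (map_poly to_ac f) = (\<lambda>x. x ^ 3 + x ^ 2 + 1)"
  unfolding f by (rule ext) (simp add: poly_map_to_ac_add map_poly_monom poly_monom)

text \<open>A root of \<open>a\<close> in the closure is a root of the iterate, so its first
  \<open>3 ^ n\<close> conjugates are distinct; they are all roots of \<open>a\<close>, whose
  coefficients lie in the base field.\<close>

lemma degree_factor_ge:
  assumes "\<not> 3 dvd m" and "a dvd poly_iterate f n" and "degree a > 0"
  shows "3 ^ n \<le> degree a"
proof -
  let ?A = "map_poly to_ac a"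
  have deg: "degree ?A = degree a"
    by (intro degree_map_poly) auto
  then obtain x where x: "poly ?A x = 0"
    using alg_closed_imp_poly_has_root[of ?A] assms by auto
  then have "((\<lambda>x. x ^ 3 + x ^ 2 + 1) ^^ n) x = 0"
    using assms(2) by (auto simp: poly_map_to_ac_mult simp flip: poly_map_to_ac_iterate poly_f_ac)
  then have inj: "inj_on (\<lambda>i. x ^ ((2 ^ m) ^ i)) {..<3 ^ n}"
    using assms char by (intro conjugates_distinct) simp_all
  have "poly ?A (x ^ ((2 ^ m) ^ i)) = 0" for i
  proof (induction i)
    case (Suc i)
    have "poly ?A ((x ^ ((2 ^ m) ^ i)) ^ CARD('a)) = poly ?A (x ^ ((2 ^ m) ^ i)) ^ CARD('a)"
      using card char by (intro poly_map_to_ac_frobenius) simp_all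
    then show ?case
      using Suc by (simp add: card mult.commute flip: power_mult)
  qed (use x in simp)
  moreover have "?A \<noteq> 0"
    using deg assms by auto
  ultimately have "card ((\<lambda>i. x ^ ((2 ^ m) ^ i)) ` {..<3 ^ n}) \<le> card {y. poly ?A y = 0}"
    by (intro card_mono poly_roots_finite) auto
  also have "\<dots> \<le> degree a"
    using card_poly_roots_bound[OF \<open>?A \<noteq> 0\<close>] deg by simp
  finally show ?thesis
    using card_image[OF inj] by simp
qed

lemma irreducible_iterate:
  assumes "\<not> 3 dvd m"
  shows "irreducible (poly_iterate f n)"
proof (rule irreducibleI)
  have deg: "degree (poly_iterate f n) = 3 ^ n"
    by (simp add: degree_poly_iterate degree_f)
  show nz: "poly_iterate f n \<noteq> 0"
    using deg by auto
  show "\<not> is_unit (poly_iterate f n)"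
    using deg nz by (simp add: is_unit_iff_degree)
  fix a b assume ab: "poly_iterate f n = a * b"
  then have nz': "a \<noteq> 0" "b \<noteq> 0"
    using nz by auto
  have sum: "degree a + degree b = 3 ^ n"
    using deg ab nz' by (simp add: degree_mult_eq)
  show "is_unit a \<or> is_unit b"
  proof (rule ccontr)
    assume "\<not> ?thesis"
    then have "degree a > 0" "degree b > 0"
      using nz' by (auto simp: is_unit_iff_degree)
    \<comment> \<open>Each of two nonunit factors would already use up the whole degree
      \<open>3 ^ n\<close>.\<close>
    then have "3 ^ n \<le> degree a" "3 ^ n \<le> degree b"
      using degree_factor_ge[OF assms] ab by auto
    with sum show False
      using \<open>degree b > 0\<close> by simp
  qed
qed

text \<open>The roots of $f$ lie in $\mathbb{F}_8$, which is contained in the coefficient field.\<close>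

lemma f_has_root:
  assumes "3 dvd m"
  shows "\<exists>c. poly f c = 0"
proof -
  have fin: "finite (UNIV :: 'a set)"
    using card by (intro card_ge_0_finite) simp
  have charL: "CHAR('a alg_closure) = 2"
    using char by simp
  have neg: "- u = u" for u :: "'a alg_closure"
    by (rule uminus_CHAR_2) (rule charL)
  have sq: "(u + v) ^ 2 = u ^ 2 + v ^ 2" for u v :: "'a alg_closure"
    using freshmans_dream[where ?'a = "'a alg_closure"] charL by simp
  have double: "u + u = 0" "u + (u + v) = v" for u v :: "'a alg_closure"
    using neg[of u] by (metis add.right_inverse, metis add.assoc add.right_inverse add_0)
  have "degree (map_poly to_ac f) = 3"
    using degree_f by (subst degree_map_poly) auto
  then obtain x where "poly (map_poly to_ac f) x = 0"
    using alg_closed_imp_poly_has_root[of "map_poly to_ac f"] by auto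
  then have "x ^ 3 + (x ^ 2 + 1) = 0"
    by (simp add: poly_f_ac add.assoc)
  then have x3: "x ^ 3 = x ^ 2 + 1"
    using neg by (metis eq_neg_iff_add_eq_0)
  \<comment> \<open>Reducing with \<open>x3\<close> and squaring once gives
    \<open>x ^ 8 = x\<close>, that is, \<open>x\<close> lies in the field with 8 elements.\<close>
  have "x ^ 4 = x * x ^ 3"
    by (simp add: numeral_eq_Suc)
  also have "\<dots> = x ^ 3 + x"
    by (subst x3) (simp add: numeral_eq_Suc algebra_simps)
  finally have x4: "x ^ 4 = x ^ 2 + 1 + x"
    by (simp add: x3)
  have "x ^ 8 = (x ^ 4) ^ 2"
    by (simp flip: power_mult)
  also have "\<dots> = x ^ 4 + 1 + x ^ 2"
    unfolding x4 sq by (simp add: x4 flip: power_mult)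
  also have "\<dots> = x"
    unfolding x4 by (simp add: ac_simps double)
  finally have x8: "x ^ 8 = x" .
  obtain k where k: "m = 3 * k"
    using assms by auto
  have "x ^ (8 ^ k) = x"
    by (induction k) (simp_all add: x8 power_mult)
  then have xq: "x ^ CARD('a) = x"
    by (simp add: card k power_mult)
  \<comment> \<open>\<open>P\<close> is \<open>X ^ q - X\<close> with \<open>q = CARD('a)\<close>.
    It has at most \<open>q\<close> roots and all \<open>q\<close> elements of the base field are
    among them, so its root \<open>x\<close> comes from the base field.\<close>
  define P where "P = monom 1 (CARD('a)) - monom (1 :: 'a alg_closure) 1"
  have P: "poly P y = y ^ CARD('a) - y" for y
    by (simp add: P_def poly_monom)
  have q: "CARD('a) > 1"
    using m card one_less_power[of "2::nat" m] by simp
  have Pdeg: "degree P = CARD('a)"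
    unfolding P_def diff_conv_add_uminus using q
    by (subst degree_add_eq_left) (simp_all add: degree_monom_eq)
  then have P0: "P \<noteq> 0"
    using q by auto
  have "range (to_ac :: 'a \<Rightarrow> _) = {y. poly P y = 0}"
  proof (rule card_seteq)
    show "finite {y. poly P y = 0}"
      using P0 by (rule poly_roots_finite)
    show "range to_ac \<subseteq> {y. poly P y = 0}"
      using finite_field_power_card[OF fin] by (auto simp: P simp flip: to_ac_power)
    show "card {y. poly P y = 0} \<le> card (range (to_ac :: 'a \<Rightarrow> _))"
      using card_poly_roots_bound[OF P0] Pdeg by (simp add: card_image inj_to_ac)
  qed
  with xq obtain c :: 'a where c: "x = to_ac c"
    by (auto simp: P)
  have "to_ac (poly f c) = poly (map_poly to_ac f) x"
    unfolding poly_f_ac c by (simp add: f poly_monom)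
  then have "poly f c = 0"
    using \<open>poly (map_poly to_ac f) x = 0\<close> by simp
  then show ?thesis ..
qed

end

theorem corollary4p5:
  fixes f :: "'a::field poly" and m :: nat
  assumes "m \<ge> 1"
    and "CARD('a) = 2 ^ m"
    and "f = monom 1 3 + monom 1 2 + 1"
  shows "stable_poly f \<longleftrightarrow> \<not> 3 dvd m"
proof
  assume "\<not> 3 dvd m"
  then show "stable_poly f"
    using irreducible_iterate[OF assms] by (simp add: stable_poly_def)
next
  assume "stable_poly f"
  \<comment> \<open>The first iterate is \<open>f\<close> itself, so a root of this cubic is enough
    to refute stability.\<close>
  then have "irreducible (poly_iterate f 1)"
    unfolding stable_poly_def by blast
  then have irr: "irreducible f"
    by (simp add: poly_iterate_def)
  show "\<not> 3 dvd m"
  proof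
    assume "3 dvd m"
    then obtain c where "poly f c = 0"
      using f_has_root[OF assms] by blast
    then obtain g where g: "f = [:- c, 1:] * g"
      by (auto simp: poly_eq_0_iff_dvd)
    have "f \<noteq> 0"
      using irr by auto
    with g have "g \<noteq> 0"
      by auto
    \<comment> \<open>Splitting off the linear factor leaves a quadratic cofactor, so neither factor
      is a unit.\<close>
    then have "degree f = 1 + degree g"
      unfolding g by (subst degree_mult_eq) auto
    then have "degree g = 2"
      using degree_f[OF assms] by simp
    moreover have "is_unit [:- c, 1:] \<or> is_unit g"
      using irr g irreducibleD by blast
    ultimately show False
      using \<open>g \<noteq> 0\<close> by (auto simp: is_unit_iff_degree)
  qed
qed

end
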